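(* For all integers $q \ge 3$ and $n \ge 3$, the set $\mathcal{CBFS}_q(n) = \mathcal{A}_q(n) \cup \mathcal{B}_q(n) \cup \mathcal{C}_q(n)$ is a non-expandable cross-bifix-free set on $BF_q(n)$; that is, $\mathcal{CBFS}_q(n)$ is a cross-bifix-free set, and for every $w \in BF_q(n) \setminus \mathcal{CBFS}_q(n)$ the set $\mathcal{CBFS}_q(n) \cup \{w\}$ is not a cross-bifix-free set.
   Context: Words. $\mathbb{Z}_q = \{0,1,\dots,q-1\}$ is an alphabet of $q$ letters and $\mathbb{Z}_q^n$ is the set of words of length $n$ over it. A word $w \in \mathbb{Z}_q^n$ is bifix-free if no non-empty proper prefix of $w$ is also a suffix of $w$. $BF_q(n)$ is the set of all bifix-free words in $\mathbb{Z}_q^n$. Two distinct words $w,w' \in BF_q(n)$ are cross-bifix-free if no non-empty strict (proper) prefix of $w$ is a suffix of $w'$ and no non-empty strict prefix of $w'$ is a suffix of $w$. A subset of $BF_q(n)$ is a cross-bifix-free set if any two distinct words in it are cross-bifix-free. A cross-bifix-free set on $BF_q(n)$ is non-expandable if the set obtained by adding to it any other word of $BF_q(n)$ is not a cross-bifix-free set. Motzkin words. Words are read as lattice paths starting at $(0,0)$: the letter $0$ is a fall step $(1,-1)$, the letter $1$ is a rise step $(1,1)$, and each of the letters $2,\dots,q-1$ is a level step $(1,0)$ carrying one of $q-2$ colors (distinct letters, distinct colors). $\mathcal{M}_{q-2}(m)$ denotes the set of $(q-2)$-colored Motzkin words of length $m \ge 0$: the words in $\mathbb{Z}_q^m$ whose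 path ends at $(m,0)$ and never goes below the $x$-axis (for $m=0$, only the empty word). For $m \ge 2$, the set of elevated $(q-2)$-colored Motzkin words of length $m$ is $\hat{\mathcal{M}}_{q-2}(m) = \{1\alpha 0 : \alpha \in \mathcal{M}_{q-2}(m-2)\}$. The sets. For $q\ge 3$, $n \ge 3$ (juxtaposition is concatenation): $\mathcal{A}_q(n) = \{\alpha\beta : \alpha \in \mathcal{M}_{q-2}(i),\ \beta \in \hat{\mathcal{M}}_{q-2}(n-i),\ 0 \le i \le \lfloor n/2 \rfloor\} \setminus \{\alpha\beta : \alpha,\beta \in \hat{\mathcal{M}}_{q-2}(n/2)\}$, where the removed set is taken to be empty if $n$ is odd; $\mathcal{B}_q(n) = \{1\alpha\beta : \alpha \in \mathcal{M}_{q-2}(i),\ \beta \in \hat{\mathcal{M}}_{q-2}(n-i-1),\ 0 \le i \le \lfloor n/2 \rfloor - 1\}$; $\mathcal{C}_q(n)$ is the set of words $\gamma 0$ with $\gamma \in \mathcal{M}_{q-2}(n-1)$ such that $\gamma$ cannot be written as $\gamma = u\beta v$ with $u,v$ (possibly empty) words and $\beta \in \hat{\mathcal{M}}_{q-2}(j)$ for some $j \ge \lceil n/2 \rceil$. *)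

theory Defs
  imports Main "HOL-Library.Sublist"
begin

definition words :: "nat \<Rightarrow> nat \<Rightarrow> nat list set" where
  "words q n = {w. length w = n \<and> set w \<subseteq> {0..<q}}"

definition bifix_free :: "'a list \<Rightarrow> bool" where
  "bifix_free w \<longleftrightarrow> \<not> (\<exists>u. u \<noteq> [] \<and> strict_prefix u w \<and> suffix u w)"

definition BF :: "nat \<Rightarrow> nat \<Rightarrow> nat list set" where
  "BF q n = {w \<in> words q n. bifix_free w}"

definition cross_bifix_free :: "'a list \<Rightarrow> 'a list \<Rightarrow> bool" where
  "cross_bifix_free w w' \<longleftrightarrow>
     \<not> (\<exists>u. u \<noteq> [] \<and> strict_prefix u w \<and> suffix u w') \<and>
     \<not> (\<exists>u. u \<noteq> [] \<and> strict_prefix u w' \<and> suffix u w)"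

definition cross_bifix_free_set :: "nat \<Rightarrow> nat \<Rightarrow> nat list set \<Rightarrow> bool" where
  "cross_bifix_free_set q n S \<longleftrightarrow>
     S \<subseteq> BF q n \<and> (\<forall>w\<in>S. \<forall>w'\<in>S. w \<noteq> w' \<longrightarrow> cross_bifix_free w w')"

definition non_expandable :: "nat \<Rightarrow> nat \<Rightarrow> nat list set \<Rightarrow> bool" where
  "non_expandable q n S \<longleftrightarrow>
     (\<forall>w \<in> BF q n - S. \<not> cross_bifix_free_set q n (insert w S))"

(* Letter 0 is a fall step, letter 1 a rise step, every other letter a (coloured) level step. *)
definition step :: "nat \<Rightarrow> int" where
  "step x = (if x = 0 then - 1 else if x = 1 then 1 else 0)"

(* Ordinate of the end point of the lattice path of w that starts at (0,0);
   the abscissa of that point is length w. *)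
definition height :: "nat list \<Rightarrow> int" where
  "height w = sum_list (map step w)"

(* k is the number of colours of level steps, so the alphabet has k + 2 letters. *)
definition motzkin :: "nat \<Rightarrow> nat \<Rightarrow> nat list set" where
  "motzkin k m = {w \<in> words (k + 2) m. height w = 0 \<and> (\<forall>u. prefix u w \<longrightarrow> 0 \<le> height u)}"

(* The guard 2 \<le> m makes the set empty for m < 2, where m - 2 would be truncated to 0. *)
definition elevated_motzkin :: "nat \<Rightarrow> nat \<Rightarrow> nat list set" where
  "elevated_motzkin k m = {[1] @ \<alpha> @ [0] | \<alpha>. 2 \<le> m \<and> \<alpha> \<in> motzkin k (m - 2)}"

definition set_A :: "nat \<Rightarrow> nat \<Rightarrow> nat list set" where
  "set_A q n =
     {\<alpha> @ \<beta> | \<alpha> \<beta> i. i \<le> n div 2 \<and> \<alpha> \<in> motzkin (q - 2) i \<and> \<beta> \<in> elevated_motzkin (q - 2) (n - i)}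
     - {\<alpha> @ \<beta> | \<alpha> \<beta>. even n \<and> \<alpha> \<in> elevated_motzkin (q - 2) (n div 2)
                            \<and> \<beta> \<in> elevated_motzkin (q - 2) (n div 2)}"

definition set_B :: "nat \<Rightarrow> nat \<Rightarrow> nat list set" where
  "set_B q n =
     {[1] @ \<alpha> @ \<beta> | \<alpha> \<beta> i. i \<le> n div 2 - 1 \<and> \<alpha> \<in> motzkin (q - 2) i
                                  \<and> \<beta> \<in> elevated_motzkin (q - 2) (n - i - 1)}"

(* (n + 1) div 2 is the ceiling of n / 2. *)
definition set_C :: "nat \<Rightarrow> nat \<Rightarrow> nat list set" where
  "set_C q n =
     {\<gamma> @ [0] | \<gamma>. \<gamma> \<in> motzkin (q - 2) (n - 1) \<and>
        \<not> (\<exists>u \<beta> v j. (n + 1) div 2 \<le> j \<and> \<beta> \<in> elevated_motzkin (q - 2) j \<and> \<gamma> = u @ \<beta> @ v)}"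

definition CBFS :: "nat \<Rightarrow> nat \<Rightarrow> nat list set" where
  "CBFS q n = set_A q n \<union> set_B q n \<union> set_C q n"

end

theory Submission
  imports Defs
begin

text \<open>
  An overlap \<open>u\<close> is a proper prefix of a word of the set and a proper suffix of a word of the set; the
  former forces its height to be \<open>\<ge> 0\<close>, the latter \<open>\<le> 0\<close>. A proper suffix of height \<open>0\<close> contains an
  elevated factor of length at least \<open>n/2\<close>, and such a factor does not fit into a prefix of height
  \<open>0\<close>, except for \<open>u = \<alpha> = \<beta>\<close> elevated of length exactly \<open>n/2\<close>, the case removed from \<open>A\<close>.

  For maximality, let \<open>w\<close> overlap no word of the set. The shortest prefix \<open>\<mu>0\<close> of negative height, if
  proper, would be a suffix of \<open>1 2\<dots>2 \<mu> 0\<close>, which lies in \<open>A\<close>; so if \<open>w\<close> descends below the axis,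
  then \<open>w = \<mu>0\<close>, and a long elevated factor of \<open>\<mu>\<close>, enlarged until it sits on the axis, would give a
  prefix of \<open>w\<close> ending a word of \<open>A\<close>. Otherwise \<open>w\<close> ends with \<open>0\<close>. If its height is positive, the
  shortest suffix \<open>1\<alpha>\<close> of positive height, if proper, would begin \<open>1 \<alpha> 2\<dots>2 0\<close>, hence \<open>w = 1\<alpha>\<close>. In both
  cases the last elevated factor of \<open>w\<close> cannot be shorter than \<open>n/2\<close>, as it would begin a word of \<open>A\<close>,
  and this puts \<open>w\<close> in \<open>A\<close> or \<open>B\<close>.
\<close>

section \<open>Heights and Motzkin words\<close>

lemma height_simps [simp]:
  "height [] = 0"
  "height (x # w) = step x + height w"
  "height (v @ w) = height v + height w"
  by (simp_all add: height_def)

lemma height_suffix_prefix: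
  assumes "u @ v = w" "height w = 0"
  shows "height v = - height u"
  using assms by auto

lemma words_append_iff:
  "v @ w \<in> words q n \<longleftrightarrow> v \<in> words q (length v) \<and> w \<in> words q (length w) \<and> n = length v + length w"
  by (auto simp: words_def)

lemma motzkin_iff:
  "w \<in> motzkin k m \<longleftrightarrow> w \<in> words (k + 2) m \<and> height w = 0 \<and> (\<forall>u v. w = u @ v \<longrightarrow> 0 \<le> height u)"
  by (auto simp: motzkin_def prefix_def)

lemma motzkin_length: "w \<in> motzkin k m \<Longrightarrow> length w = m"
  by (simp add: motzkin_def words_def)

lemma motzkin_prefix: "u @ v \<in> motzkin k m \<Longrightarrow> 0 \<le> height u"
  by (auto simp: motzkin_def)

lemma motzkin_suffix:
  assumes "u @ v \<in> motzkin k m"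
  shows "height v \<le> 0"
proof -
  have "height (u @ v) = 0" using assms by (simp add: motzkin_def)
  then show ?thesis using motzkin_prefix[OF assms] by simp
qed

lemma motzkin_Nil [simp]: "[] \<in> motzkin k m \<longleftrightarrow> m = 0"
  by (auto simp: motzkin_iff words_def)

lemma motzkin_append:
  assumes "v \<in> motzkin k a" "w \<in> motzkin k b"
  shows "v @ w \<in> motzkin k (a + b)"
  using assms unfolding motzkin_def words_def by (auto simp: prefix_append)

lemma motzkin_level: "2 \<le> c \<Longrightarrow> c < k + 2 \<Longrightarrow> [c] \<in> motzkin k 1"
  by (auto simp: motzkin_def words_def step_def prefix_Cons)

lemma motzkin_replicate: "1 \<le> k \<Longrightarrow> replicate j 2 \<in> motzkin k j"
proof (induction j)
  case (Suc j)
  then show ?case using motzkin_append[OF motzkin_level[of 2 k], of "replicate j 2" j] by simp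
qed simp

text \<open>Elevated words are those whose path meets the axis only at its two ends: a positive
  height after the first letter forces a rise there, and a positive height before the last letter
  forces a final fall. In this form any cut of the word can be tested by its height.\<close>

lemma elevated_iff:
  "b \<in> elevated_motzkin k m \<longleftrightarrow> 2 \<le> m \<and> b \<in> words (k + 2) m \<and> height b = 0 \<and>
     (\<forall>u v. b = u @ v \<longrightarrow> u \<noteq> [] \<longrightarrow> v \<noteq> [] \<longrightarrow> 0 < height u)" (is "?L \<longleftrightarrow> ?R")
proof
  assume ?L
  then obtain a where a: "b = 1 # a @ [0]" "2 \<le> m" "a \<in> motzkin k (m - 2)"
    by (auto simp: elevated_motzkin_def)
  have "0 < height u" if uv: "b = u @ v" "u \<noteq> []" "v \<noteq> []" for u v
  proof -
    from uv(2) uv(1) a(1) obtain u' where u: "u = 1 # u'" "u' @ v = a @ [0]"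
      by (cases u) auto
    from uv(3) u(2) have "u' @ butlast v = a"
      by (metis butlast_append butlast_snoc)
    then have "0 \<le> height u'" using a(3) motzkin_prefix by blast
    then show ?thesis using u by (simp add: step_def)
  qed
  with a show ?R by (auto simp: motzkin_def words_def step_def)
next
  assume R: ?R
  then obtain c b' where "b = c # b'" "b' \<noteq> []" by (cases b; cases "tl b") (auto simp: words_def)
  then obtain a d where b: "b = c # a @ [d]" by (metis rev_exhaust)
  have "0 < height [c]" "0 < height (c # a)" using R b by (metis append_Cons append_Nil list.distinct(1) Nil_is_append_conv)+
  then have c: "c = 1" and d: "d = 0" and "height a = 0"
    using R b by (auto simp: step_def split: if_splits)
  moreover have "0 \<le> height u" if "a = u @ v" for u v
  proof -
    have "b = (c # u) @ v @ [d]" using b that by simp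
    then have "0 < height (c # u)" using R by blast
    then show ?thesis using c by (simp add: step_def)
  qed
  ultimately have "a \<in> motzkin k (m - 2)" using R b by (auto simp: motzkin_iff words_def)
  then show ?L using R b c d by (auto simp: elevated_motzkin_def)
qed

lemma elevated_motzkin: "b \<in> elevated_motzkin k m \<Longrightarrow> b \<in> motzkin k m"
  unfolding elevated_iff motzkin_iff
  by (metis append_Nil2 height_simps(1) order_less_imp_le order_refl)

lemma elevated_length: "b \<in> elevated_motzkin k m \<Longrightarrow> length b = m \<and> 2 \<le> m"
  by (auto simp: elevated_iff words_def)

lemma elevatedI:
  "a \<in> motzkin k m \<Longrightarrow> 1 # a @ [0] \<in> elevated_motzkin k (m + 2)"
  by (auto simp: elevated_motzkin_def)

lemma elevated_hd: "b \<in> elevated_motzkin k m \<Longrightarrow> hd b = 1"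
  by (auto simp: elevated_motzkin_def)

lemma elevated_prefix_pos:
  "u @ v \<in> elevated_motzkin k m \<Longrightarrow> u \<noteq> [] \<Longrightarrow> v \<noteq> [] \<Longrightarrow> 0 < height u"
  unfolding elevated_iff by blast

text \<open>A cut at height 0 cannot fall strictly inside \<open>b\<close>, whose path starts on the
  axis and meets it only at its ends; \<open>v \<noteq> []\<close> excludes the cut after
  \<open>b\<close>.\<close>

lemma prefix_zero_of_motzkin_elevated:
  assumes "b \<in> elevated_motzkin k m" "height a = 0" "a @ b = u @ v" "v \<noteq> []" "height u = 0"
  shows "prefix u a"
proof -
  consider t where "a = u @ t" | t where "u = a @ t" "b = t @ v"
    using assms(3) by (auto simp: append_eq_append_conv2)
  then show ?thesis
  proof cases
    case 2
    then have "t = []" using elevated_prefix_pos[of t v k m] assms by auto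
    then show ?thesis using 2 by simp
  qed simp
qed

lemma suffix_zero_of_motzkin_elevated:
  assumes "b \<in> elevated_motzkin k m" "a @ b = u @ v" "v \<noteq> []" "height v = 0"
  shows "suffix b v"
proof -
  consider t where "v = t @ b" | t where "b = t @ v"
    using assms(2) by (auto simp: append_eq_append_conv2)
  then show ?thesis
  proof cases
    case 2
    have "height b = 0" using assms(1) by (simp add: elevated_iff)
    then have "t = []" using elevated_prefix_pos[of t v k m] assms 2 by auto
    then show ?thesis using 2 by simp
  qed (simp add: suffix_def)
qed

section \<open>Decompositions of words\<close>

lemma shortest_prefix:
  assumes "P w"
  obtains u v where "w = u @ v" "P u" "\<And>x y. u = x @ y \<Longrightarrow> y \<noteq> [] \<Longrightarrow> \<not> P x"
  using assms
proof (induction w arbitrary: thesis rule: length_induct)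
  case (1 w)
  show ?case
  proof (cases "\<exists>x y. w = x @ y \<and> y \<noteq> [] \<and> P x")
    case True
    then obtain x y where xy: "w = x @ y" "y \<noteq> []" "P x" by blast
    show ?thesis
      by (rule "1.IH"[rule_format, OF _ _ xy(3)]) (use xy "1.prems" in auto)
  next
    case False
    then show ?thesis using "1.prems"(1)[of w "[]"] "1.prems"(2) by auto
  qed
qed

lemma shortest_suffix:
  assumes "P w"
  obtains u v where "w = u @ v" "P v" "\<And>x y. v = x @ y \<Longrightarrow> x \<noteq> [] \<Longrightarrow> \<not> P y"
proof -
  have "P (rev (rev w))" using assms by simp
  from shortest_prefix[of "\<lambda>x. P (rev x)", OF this] obtain u v where
    *: "rev w = u @ v" "P (rev u)" "\<And>x y. u = x @ y \<Longrightarrow> y \<noteq> [] \<Longrightarrow> \<not> P (rev x)" by blast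
  show thesis
  proof (rule that)
    show "w = rev v @ rev u" using *(1) by (metis rev_append rev_rev_ident)
    show "\<not> P y" if "rev u = x @ y" "x \<noteq> []" for x y
      using *(3)[of "rev y" "rev x"] that by (metis rev_append rev_is_Nil_conv rev_rev_ident)
  qed (rule *(2))
qed

text \<open>The shortest prefix of negative height must end with a fall from height 0, and no proper
  prefix of it is negative.\<close>

lemma first_descent:
  assumes "w \<in> words (k + 2) n" "w = u @ v" "height u < 0"
  obtains a y where "w = a @ [0] @ y" "a \<in> motzkin k (length a)"
proof -
  from shortest_prefix[of "\<lambda>x. height x < 0", OF assms(3)] obtain p s where
    p: "u = p @ s" "height p < 0" "\<And>x y. p = x @ y \<Longrightarrow> y \<noteq> [] \<Longrightarrow> \<not> height x < 0" by blast
  then obtain a c where a: "p = a @ [c]" by (cases p rule: rev_cases) auto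
  have nn: "0 \<le> height x" if "a = x @ y" for x y using p(3)[of x "y @ [c]"] that a by auto
  from this[of a "[]"] p(2) a have "c = 0" "height a = 0"
    by (auto simp: step_def split: if_splits)
  then show thesis using that[of a "s @ v"] nn assms(1,2) p(1) a
    by (auto simp: motzkin_iff words_append_iff)
qed

lemma last_ascent:
  assumes "w \<in> words (k + 2) n" "0 < height w"
  obtains x a where "w = x @ [1] @ a" "a \<in> motzkin k (length a)"
proof -
  from shortest_suffix[of "\<lambda>x. 0 < height x", OF assms(2)] obtain x p where
    p: "w = x @ p" "0 < height p" "\<And>x y. p = x @ y \<Longrightarrow> x \<noteq> [] \<Longrightarrow> \<not> 0 < height y" by blast
  then obtain a c where a: "p = c # a" by (cases p) auto
  have np: "height y \<le> 0" if "a = x @ y" for x y using p(3)[of "c # x" y] that a by auto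
  from this[of "[]" a] p(2) a have c: "c = 1" "height a = 0"
    by (auto simp: step_def split: if_splits)
  have "0 \<le> height x" if "a = x @ y" for x y
    using np[OF that] height_suffix_prefix[of x y a] that c by simp
  then show thesis using that[of x a] assms(1) p(1) a c
    by (auto simp: motzkin_iff words_def)
qed

text \<open>The shortest non-empty suffix of height 0 is the elevated factor: its proper non-empty
  suffixes have height at most 0, as in every Motzkin word, and not 0 by minimality. The final
  letter \<open>0\<close> excludes a single level step.\<close>

lemma last_elevated_factor:
  assumes "w @ [0] \<in> motzkin k m"
  obtains a b where "w @ [0] = a @ b" "a \<in> motzkin k (length a)" "b \<in> elevated_motzkin k (length b)"
proof -
  have "w @ [0] \<noteq> [] \<and> height (w @ [0]) = 0" using assms by (simp add: motzkin_def)
  then obtain a b where ab: "w @ [0] = a @ b" "b \<noteq> [] \<and> height b = 0"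
      "\<And>x y. b = x @ y \<Longrightarrow> x \<noteq> [] \<Longrightarrow> \<not> (y \<noteq> [] \<and> height y = 0)"
    by (rule shortest_suffix) blast
  then have b: "w @ [0] = a @ b" "b \<noteq> []" "height b = 0"
      "\<And>x y. b = x @ y \<Longrightarrow> x \<noteq> [] \<Longrightarrow> y \<noteq> [] \<Longrightarrow> height y \<noteq> 0" by auto
  have m: "a @ b \<in> motzkin k m" using assms b(1) by simp
  then have wd: "a \<in> words (k + 2) (length a)" "b \<in> words (k + 2) (length b)"
    by (auto simp: motzkin_def words_append_iff)
  from m b(3) have a0: "height a = 0" by (simp add: motzkin_def)
  have "0 \<le> height x" if "a = x @ y" for x y using motzkin_prefix[of x "y @ b"] m that by simp
  with wd a0 have a: "a \<in> motzkin k (length a)" by (auto simp: motzkin_iff)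
  have "0 < height x" if xy: "b = x @ y" "x \<noteq> []" "y \<noteq> []" for x y
    using motzkin_suffix[of "a @ x" y k m] m b(4)[OF xy] height_suffix_prefix[of x y b] xy b(3) by simp
  moreover have "b \<noteq> [c]" for c
  proof
    assume "b = [c]"
    with b(1,3) show False by (simp add: step_def)
  qed
  then have "2 \<le> length b" using b(2) by (cases b; cases "tl b") auto
  ultimately have "b \<in> elevated_motzkin k (length b)" using wd b by (auto simp: elevated_iff)
  with that b(1) a show thesis by blast
qed

text \<open>Cut the word at the first return to the axis after \<open>b\<close>; \<open>b'\<close> is the last elevated factor of
  what precedes the cut.\<close>

lemma elevated_factor_on_axis:
  assumes m: "x @ b @ y \<in> motzkin k m" and b: "b \<in> elevated_motzkin k j"
  obtains a b' y' where "x @ b @ y = a @ b' @ y'" "a \<in> motzkin k (length a)"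
    "b' \<in> elevated_motzkin k (length b')" "j \<le> length b'"
proof -
  have "height (x @ b @ y) \<le> 0" using m by (simp add: motzkin_def)
  from shortest_prefix[of "\<lambda>y. height (x @ b @ y) \<le> 0", OF this] obtain s y' where
    s: "y = s @ y'" "height (x @ b @ s) \<le> 0"
       "\<And>p q. s = p @ q \<Longrightarrow> q \<noteq> [] \<Longrightarrow> \<not> height (x @ b @ p) \<le> 0" by blast
  have m': "(x @ b @ s) @ y' \<in> motzkin k m" using m s(1) by simp
  have "0 \<le> height p" if "x @ b @ s = p @ r" for p r
    using motzkin_prefix[of p "r @ y'"] m' that by simp
  moreover have s0: "height (x @ b @ s) = 0" using motzkin_prefix[OF m'] s(2) by linarith
  ultimately have mu: "x @ b @ s \<in> motzkin k (length (x @ b @ s))"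
    using m' by (auto simp: motzkin_iff words_append_iff)
  have "\<exists>w. x @ b @ s = w @ [0]"
  proof (cases s rule: rev_cases)
    case Nil
    from b obtain b0 where "b = b0 @ [0]" by (force simp: elevated_motzkin_def)
    then show ?thesis using Nil by simp
  next
    case (snoc s' c)
    then have "0 < height (x @ b @ s')" using s(3)[of s' "[c]"] by simp
    then have "step c < 0" using s(2) snoc by simp
    then show ?thesis using snoc by (simp add: step_def split: if_splits)
  qed
  then obtain w where "x @ b @ s = w @ [0]" by blast
  from last_elevated_factor[of w k] mu this obtain a b' where
    ab: "x @ b @ s = a @ b'" "a \<in> motzkin k (length a)" "b' \<in> elevated_motzkin k (length b')"
    by metis
  \<comment> \<open>If \<open>b'\<close> were shorter than \<open>b\<close>, the cut after
    \<open>a\<close>, at height 0, would come after the start of \<open>b\<close>. Strictly inside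
    \<open>b\<close> the height is positive, and from the end of \<open>b\<close> on a cut at height
    0 contradicts the minimality of \<open>s\<close>.\<close>
  have "j \<le> length b'"
  proof (rule ccontr)
    assume "\<not> j \<le> length b'"
    then have l: "length b' < length b" using elevated_length[OF b] by simp
    have b'0: "b' \<noteq> []" using elevated_length[OF ab(3)] by auto
    have a0: "height a = 0" using ab(2) by (simp add: motzkin_def)
    have x0: "0 \<le> height x" using motzkin_prefix[OF m] .
    have "length a > length x" using l arg_cong[OF ab(1), of length] by simp
    moreover from ab(1) obtain t where "x = a @ t \<and> t @ b @ s = b' \<or> x @ t = a \<and> b @ s = t @ b'"
      unfolding append_eq_append_conv2 by blast
    ultimately have t: "a = x @ t" "t \<noteq> []" "b @ s = t @ b'" by auto
    then obtain r where "b = t @ r \<and> r @ s = b' \<or> b @ r = t \<and> s = r @ b'"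
      unfolding append_eq_append_conv2 by blast
    then consider r where "b = t @ r" "r \<noteq> []" | p where "t = b @ p" "s = p @ b'"
      by (cases "r = []") auto
    then show False
    proof cases
      case 1
      then show False using elevated_prefix_pos[of t r k j] b t a0 x0 by simp
    next
      case 2
      then show False using s(3)[OF 2(2) b'0] t a0 by simp
    qed
  qed
  then show thesis using that[of a b' y'] ab s(1) by simp
qed

section \<open>The sets are free of overlaps\<close>

text \<open>A prefix of height 0 does not cut into \<open>b\<close>, so \<open>u\<close> lies within
  \<open>a\<close>; the two length bounds then leave only equality.\<close>

lemma half_overlap_unique:
  assumes a: "a \<in> motzkin k i" "i \<le> n div 2" and b: "b \<in> elevated_motzkin k (n - i)"
    and w: "a @ b = u @ v" and u: "height u = 0" "n div 2 \<le> length u" and v: "v \<noteq> []"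
  shows "u = a \<and> i = n div 2"
proof -
  have "prefix u a"
    using prefix_zero_of_motzkin_elevated[OF b _ w v u(1)] a by (simp add: motzkin_def)
  moreover have "length a \<le> length u" using a u motzkin_length by fastforce
  ultimately have "u = a" using prefix_length_le prefix_order.antisym
    by (metis le_antisym not_equal_is_parallel parallel_def)
  then show ?thesis using a u motzkin_length by fastforce
qed

text \<open>Removal from \<open>set_A\<close> concerns a word in all its factorizations. By
  \<open>half_overlap_unique\<close>, two elevated halves of \<open>a @ b\<close> can only be
  \<open>a\<close> and \<open>b\<close> themselves, so a condition on \<open>a\<close>
  suffices.\<close>

lemma set_A_I:
  assumes "a \<in> motzkin (q - 2) i" "b \<in> elevated_motzkin (q - 2) (n - i)" "i \<le> n div 2"
    and ne: "even n \<Longrightarrow> i = n div 2 \<Longrightarrow> a \<notin> elevated_motzkin (q - 2) i"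
  shows "a @ b \<in> set_A q n"
proof -
  have False if x: "even n" "x \<in> elevated_motzkin (q - 2) (n div 2)"
      "y \<in> elevated_motzkin (q - 2) (n div 2)" "a @ b = x @ y" for x y
  proof -
    have "y \<noteq> []" "height x = 0" "n div 2 \<le> length x"
      using elevated_length x(2,3) by (auto simp: elevated_iff words_def)
    then have "x = a \<and> i = n div 2"
      using half_overlap_unique[OF assms(1,3,2) x(4)] by blast
    then show False using ne x by auto
  qed
  then show ?thesis using assms(1-3) unfolding set_A_def by blast
qed

lemma set_A_E:
  assumes "w \<in> set_A q n"
  obtains a b i where "w = a @ b" "a \<in> motzkin (q - 2) i" "b \<in> elevated_motzkin (q - 2) (n - i)"
    "i \<le> n div 2" "even n \<Longrightarrow> i = n div 2 \<Longrightarrow> a \<notin> elevated_motzkin (q - 2) i"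
proof -
  from assms obtain a b i where
    *: "w = a @ b" "a \<in> motzkin (q - 2) i" "b \<in> elevated_motzkin (q - 2) (n - i)" "i \<le> n div 2"
    by (auto simp: set_A_def)
  have "a \<notin> elevated_motzkin (q - 2) i" if "even n" "i = n div 2"
  proof -
    have "n - i = n div 2" using that by auto
    then show ?thesis using assms * that by (auto simp: set_A_def)
  qed
  with * that show thesis by blast
qed

lemma CBFS_words:
  assumes "3 \<le> q" "3 \<le> n" "w \<in> CBFS q n"
  shows "w \<in> words q n"
proof -
  have q: "q - 2 + 2 = q" using assms by simp
  have m: "a \<in> words q i" if "a \<in> motzkin (q - 2) i" for a i
    using that q by (simp add: motzkin_def)
  have e: "a \<in> words q i \<and> 2 \<le> i" if "a \<in> elevated_motzkin (q - 2) i" for a i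
    using that q by (simp add: elevated_iff)
  consider "w \<in> set_A q n" | "w \<in> set_B q n" | "w \<in> set_C q n"
    using assms by (auto simp: CBFS_def)
  then show ?thesis
  proof cases
    case 1
    then show ?thesis by (elim set_A_E) (use m e in \<open>fastforce simp: words_def\<close>)
  next
    case 2
    then show ?thesis using m e assms unfolding set_B_def words_def by fastforce
  next
    case 3
    then show ?thesis using m assms unfolding set_C_def words_def by fastforce
  qed
qed

text \<open>In \<open>set_B\<close> the opening rise keeps non-empty prefixes above the axis, so
  height 0 leaves only \<open>set_A\<close> and \<open>set_C\<close>; in \<open>set_C\<close> a
  proper prefix stops before the final fall.\<close>

lemma CBFS_prefix:
  assumes "w \<in> CBFS q n" "w = u @ v" "u \<noteq> []" "v \<noteq> []"
  shows "0 \<le> height u"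
    and "height u = 0 \<Longrightarrow> w \<in> set_A q n \<or> (\<exists>\<gamma>. w = \<gamma> @ [0] \<and> w \<in> set_C q n \<and> prefix u \<gamma>)"
proof -
  have "0 \<le> height u \<and>
    (height u = 0 \<longrightarrow> w \<in> set_A q n \<or> (\<exists>\<gamma>. w = \<gamma> @ [0] \<and> w \<in> set_C q n \<and> prefix u \<gamma>))"
  proof -
    consider "w \<in> set_A q n" | "w \<in> set_B q n" | "w \<in> set_C q n"
      using assms by (auto simp: CBFS_def)
    then show ?thesis
    proof cases
      case 1
      then obtain a b i j where "w = a @ b" "a \<in> motzkin (q - 2) i" "b \<in> elevated_motzkin (q - 2) j"
        by (elim set_A_E)
      then have "u @ v \<in> motzkin (q - 2) (i + j)"
        using assms(2) motzkin_append elevated_motzkin by metis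
      then show ?thesis using motzkin_prefix 1 by blast
    next
      case 2
      then obtain a b i j where w: "w = 1 # a @ b" "a \<in> motzkin (q - 2) i" "b \<in> elevated_motzkin (q - 2) j"
        by (auto simp: set_B_def)
      with assms(2,3) obtain u' where u: "u = 1 # u'" "u' @ v = a @ b" by (cases u) auto
      have "u' @ v \<in> motzkin (q - 2) (i + j)"
        unfolding u using w motzkin_append elevated_motzkin by metis
      then have "0 \<le> height u'" by (rule motzkin_prefix)
      then show ?thesis using u(1) by (simp add: step_def)
    next
      case 3
      then obtain g where g: "w = g @ [0]" "g \<in> motzkin (q - 2) (n - 1)" by (auto simp: set_C_def)
      then have "g = u @ butlast v" using assms(2,4) by (metis butlast_append butlast_snoc)
      then show ?thesis using motzkin_prefix[of u "butlast v"] g 3 by auto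
    qed
  qed
  then show "0 \<le> height u"
    and "height u = 0 \<Longrightarrow> w \<in> set_A q n \<or> (\<exists>\<gamma>. w = \<gamma> @ [0] \<and> w \<in> set_C q n \<and> prefix u \<gamma>)"
    by auto
qed

text \<open>The final fall makes proper suffixes of \<open>set_C\<close> words negative. In the
  other two sets a suffix of height 0 contains the whole last elevated factor, which the bound on
  \<open>i\<close> makes at least half as long as the word.\<close>

lemma CBFS_suffix:
  assumes "2 \<le> n" "w \<in> CBFS q n" "w = u @ v" "u \<noteq> []" "v \<noteq> []"
  shows "height v \<le> 0"
    and "height v = 0 \<Longrightarrow> \<exists>b j. (n + 1) div 2 \<le> j \<and> b \<in> elevated_motzkin (q - 2) j \<and> suffix b v"
proof -
  have "height v \<le> 0 \<and>
    (height v = 0 \<longrightarrow> (\<exists>b j. (n + 1) div 2 \<le> j \<and> b \<in> elevated_motzkin (q - 2) j \<and> suffix b v))"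
  proof -
    consider "w \<in> set_A q n" | "w \<in> set_B q n" | "w \<in> set_C q n"
      using assms by (auto simp: CBFS_def)
    then show ?thesis
    proof cases
      case 1
      then obtain a b i where w: "w = a @ b" "a \<in> motzkin (q - 2) i"
        "b \<in> elevated_motzkin (q - 2) (n - i)" "i \<le> n div 2"
        by (elim set_A_E)
      then have "u @ v \<in> motzkin (q - 2) (i + (n - i))"
        using assms(3) motzkin_append elevated_motzkin by metis
      then have "height v \<le> 0" by (rule motzkin_suffix)
      moreover have "suffix b v" if "height v = 0"
        using suffix_zero_of_motzkin_elevated[OF w(3) _ assms(5) that, of a u] w(1) assms(3) by simp
      moreover have "(n + 1) div 2 \<le> n - i" using w(4) by linarith
      ultimately show ?thesis using w(3) by blast
    next
      case 2
      then obtain a b i where w: "w = 1 # a @ b" "a \<in> motzkin (q - 2) i"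
        "b \<in> elevated_motzkin (q - 2) (n - i - 1)" "i \<le> n div 2 - 1"
        by (auto simp: set_B_def)
      with assms(3,4) obtain u' where u: "u' @ v = a @ b" by (cases u) auto
      have "u' @ v \<in> motzkin (q - 2) (i + (n - i - 1))"
        unfolding u using w motzkin_append elevated_motzkin by metis
      then have "height v \<le> 0" by (rule motzkin_suffix)
      moreover have "suffix b v" if "height v = 0"
        using suffix_zero_of_motzkin_elevated[OF w(3) _ assms(5) that, of a u'] u by simp
      moreover have "(n + 1) div 2 \<le> n - i - 1" using w(4) assms(1) by linarith
      ultimately show ?thesis using w(3) by blast
    next
      case 3
      then obtain g where g: "w = g @ [0]" "g \<in> motzkin (q - 2) (n - 1)" by (auto simp: set_C_def)
      then obtain v' where "v = v' @ [0]" "g = u @ v'"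
        using assms(3,5) by (metis append_butlast_last_id butlast_append butlast_snoc last_appendR last_snoc)
      moreover have "height v' \<le> 0" using motzkin_suffix g(2) calculation(2) by blast
      ultimately show ?thesis by (simp add: step_def)
    qed
  qed
  then show "height v \<le> 0"
    and "height v = 0 \<Longrightarrow> \<exists>b j. (n + 1) div 2 \<le> j \<and> b \<in> elevated_motzkin (q - 2) j \<and> suffix b v"
    by auto
qed

text \<open>The words \<open>w\<close> and \<open>w'\<close> may coincide, so both bifix-freeness
  and cross-bifix-freeness follow.\<close>

lemma CBFS_no_overlap:
  assumes n: "2 \<le> n" and w: "w \<in> CBFS q n" "w = u @ v" "v \<noteq> []"
    and w': "w' \<in> CBFS q n" "w' = u' @ u" "u' \<noteq> []" and u: "u \<noteq> []"
  shows False
proof -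
  have u0: "height u = 0"
    using CBFS_prefix(1)[OF w(1,2) u w(3)] CBFS_suffix(1)[OF n w'(1,2,3) u] by linarith
  then obtain b j where b: "(n + 1) div 2 \<le> j" "b \<in> elevated_motzkin (q - 2) j" "suffix b u"
    using CBFS_suffix(2)[OF n w'(1,2,3) u] by blast
  from CBFS_prefix(2)[OF w(1,2) u w(3) u0]
  show False
  proof
    assume "w \<in> set_A q n"
    then obtain a c i where a: "w = a @ c" "a \<in> motzkin (q - 2) i" "c \<in> elevated_motzkin (q - 2) (n - i)"
      "i \<le> n div 2" "even n \<Longrightarrow> i = n div 2 \<Longrightarrow> a \<notin> elevated_motzkin (q - 2) i"
      using set_A_E by blast
    have l: "j \<le> length u" using suffix_length_le[OF b(3)] elevated_length[OF b(2)] by simp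
    have ac: "a @ c = u @ v" and nl: "n div 2 \<le> length u" using a(1) w(2) l b(1) by auto
    have ua: "u = a" "i = n div 2"
      using half_overlap_unique[OF a(2,4,3) ac u0 nl w(3)] by auto
    then have "length u = n div 2" using motzkin_length a(2) by blast
    \<comment> \<open>The ceiling of \<open>n / 2\<close> is at most \<open>j\<close>, hence at most
      its floor. So \<open>b\<close> fills all of \<open>u\<close>, and \<open>a = u = b\<close> is
      elevated, the case removed from \<open>set_A\<close>.\<close>
    then have "even n" "j = n div 2" using l b(1) by presburger+
    moreover have "b = u" using b(3) \<open>length u = n div 2\<close> calculation(2) elevated_length[OF b(2)]
      by (auto simp: suffix_def)
    ultimately show False using a(5) b(2) ua by auto
  next
    assume "\<exists>\<gamma>. w = \<gamma> @ [0] \<and> w \<in> set_C q n \<and> prefix u \<gamma>"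
    then obtain g where g: "w = g @ [0]" "w \<in> set_C q n" "prefix u g" by blast
    from b(3) g(3) obtain x y where "g = x @ b @ y" by (auto simp: suffix_def prefix_def)
    then show False using g(1,2) b(1,2) unfolding set_C_def by blast
  qed
qed

section \<open>The sets are maximal\<close>

text \<open>The assumptions \<open>P\<close> and \<open>S\<close> are contradicted by explicit
  members, completed to length \<open>n\<close> with level steps \<open>2\<close>, which exist
  because \<open>q \<ge> 3\<close>.\<close>

lemma maximality:
  assumes q: "3 \<le> q" and n: "3 \<le> n" and w: "w \<in> words q n"
    and P: "\<And>u v s. w = u @ v \<Longrightarrow> u \<noteq> [] \<Longrightarrow> v \<noteq> [] \<Longrightarrow> s @ u \<notin> CBFS q n"
    and S: "\<And>u v s. w = v @ u \<Longrightarrow> u \<noteq> [] \<Longrightarrow> v \<noteq> [] \<Longrightarrow> u @ s \<notin> CBFS q n"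
  shows "w \<in> CBFS q n"
proof -
  define k where "k = q - 2"
  have k: "1 \<le> k" "q = k + 2" using q by (auto simp: k_def)
  have wk: "w \<in> words (k + 2) n" and lw: "length w = n" using w k by (auto simp: words_def)
  have A_I: "a @ b \<in> CBFS q n" if "a \<in> motzkin k i" "b \<in> elevated_motzkin k (n - i)" "i \<le> n div 2"
    "even n \<Longrightarrow> i = n div 2 \<Longrightarrow> a \<notin> elevated_motzkin k i" for a b i
    using set_A_I[of a q i b n] that by (auto simp: CBFS_def k_def)
  have lev: "1 # replicate (m - 2) 2 @ [0] \<in> elevated_motzkin k m" if "2 \<le> m" for m
    using elevatedI[OF motzkin_replicate[OF k(1)], of "m - 2"] unfolding le_add_diff_inverse2[OF that] .
  have E: "b \<in> CBFS q n" if "b \<in> elevated_motzkin k n" for b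
    using A_I[of "[]" 0 b] that n by simp
  \<comment> \<open>Padding on the left with level steps makes the prefix \<open>a @ b\<close> the
    end of a word of \<open>set_A\<close>. The padding is non-empty because \<open>y\<close> is, so
    the first factor starts with \<open>2\<close> and the removed set is avoided.\<close>
  have axis: False
    if "w = a @ b @ y" "y \<noteq> []" "a \<in> motzkin k (length a)"
      "b \<in> elevated_motzkin k (length b)" "(n + 1) div 2 \<le> length b" for a b y
  proof -
    let ?r = "replicate (n - length (a @ b)) 2"
    have lt: "length (a @ b) < n" using that(1,2) lw by auto
    have mot: "?r @ a \<in> motzkin k (n - length b)"
      using motzkin_append[OF motzkin_replicate[OF k(1)] that(3), of "n - length (a @ b)"] lt by simp
    have "hd (?r @ a) = 2" using lt by (simp add: hd_append)
    then have "?r @ a \<notin> elevated_motzkin k m" for m using elevated_hd[of "?r @ a"] by force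
    moreover have "n - (n - length b) = length b" "n - length b \<le> n div 2" using lt that(5) by simp_all
    ultimately have "(?r @ a) @ b \<in> CBFS q n" using A_I[OF mot] that(4) by simp
    moreover have "a @ b \<noteq> []" using elevated_length[OF that(4)] by auto
    ultimately show False using P[of "a @ b" y ?r] that(1,2) by simp
  qed
  show ?thesis
  proof (cases "\<exists>u v. w = u @ v \<and> height u < 0")
    case True
    then obtain a y where a: "w = a @ [0] @ y" "a \<in> motzkin k (length a)"
      using first_descent[OF wk] by metis
    have "y = []"
    proof (rule ccontr)
      assume y: "y \<noteq> []"
      let ?r = "replicate (n - 2 - length a) 2"
      have lt: "length a \<le> n - 2" using y lw a by (cases y) auto
      have "n - 2 - length a + length a + 2 = n" using lt n by simp
      then have "1 # (?r @ a) @ [0] \<in> elevated_motzkin k n"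
        using elevatedI[OF motzkin_append[OF motzkin_replicate[OF k(1)] a(2)], of "n - 2 - length a"]
        by metis
      from E[OF this] show False using P[of "a @ [0]" y "1 # ?r"] a y by simp
    qed
    with a have w0: "w = a @ [0]" and la: "length a = n - 1" using lw by auto
    have "\<not> (\<exists>x b y j. (n + 1) div 2 \<le> j \<and> b \<in> elevated_motzkin k j \<and> a = x @ b @ y)"
    proof
      assume "\<exists>x b y j. (n + 1) div 2 \<le> j \<and> b \<in> elevated_motzkin k j \<and> a = x @ b @ y"
      then obtain x b y j where b: "(n + 1) div 2 \<le> j" "b \<in> elevated_motzkin k j" "a = x @ b @ y" by blast
      \<comment> \<open>The fact \<open>axis\<close> asks for a factor that starts on the axis; the
        given one is replaced by such a factor that is no shorter.\<close>
      with a(2) obtain c b' y' where c: "a = c @ b' @ y'" "c \<in> motzkin k (length c)"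
        "b' \<in> elevated_motzkin k (length b')" "j \<le> length b'"
        using elevated_factor_on_axis[of x b y k "length a" j] by metis
      then show False using axis[of c b' "y' @ [0]"] w0 b(1) by auto
    qed
    then show ?thesis using a(2) w0 la unfolding CBFS_def set_C_def k_def by auto
  next
    case False
    then have nn: "0 \<le> height u" if "w = u @ v" for u v using that by force
    from lw n obtain w0 c where w0: "w = w0 @ [c]" "w0 \<noteq> []" by (cases w rule: rev_cases) fastforce+
    have "c < q" using w w0 by (auto simp: words_def)
    \<comment> \<open>A last letter \<open>1\<close> would begin the word \<open>1 2...2 0\<close>,
      and a level letter \<open>c\<close> the word \<open>c 1 2...2 0\<close>; both lie in
      \<open>set_A\<close>.\<close>
    have c0: "c = 0"
    proof (rule ccontr)
      assume "c \<noteq> 0"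
      then consider "c = 1" | "2 \<le> c" by linarith
      then show False
      proof cases
        case 1
        show False using E[OF lev[of n]] S[OF w0(1) _ w0(2), of "replicate (n - 2) 2 @ [0]"] 1 n by simp
      next
        case 2
        have "[c] \<in> motzkin k 1" using motzkin_level 2 \<open>c < q\<close> k by simp
        moreover have "[c] \<notin> elevated_motzkin k m" for m using elevated_length[of "[c]" k m] by auto
        ultimately have "[c] @ (1 # replicate (n - 1 - 2) 2 @ [0]) \<in> CBFS q n"
          using A_I[OF _ lev[of "n - 1"], where a = "[c]"] n by simp
        then show False using S[OF w0(1) _ w0(2)] by blast
      qed
    qed
    \<comment> \<open>The filler from \<open>lev\<close> completes \<open>b\<close> to a word of
      \<open>set_A\<close>; the strict bound on \<open>length b\<close> keeps it out of the removed
      set.\<close>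
    have short: False if "w = x @ b" "x \<noteq> []" "b \<in> elevated_motzkin k (length b)" "2 * length b < n" for x b
    proof -
      have bm: "b \<in> motzkin k (length b)" and "2 \<le> length b"
        using elevated_motzkin[OF that(3)] elevated_length[OF that(3)] by auto
      then have l: "2 \<le> n - length b" "length b \<le> n div 2" and ne: "\<not> (even n \<and> length b = n div 2)"
        using that(4) by auto
      have "b @ (1 # replicate (n - length b - 2) 2 @ [0]) \<in> CBFS q n"
        by (rule A_I[OF bm lev[OF l(1)] l(2)]) (use ne in blast)
      moreover have "b \<noteq> []" using \<open>2 \<le> length b\<close> by auto
      ultimately show False using S[OF that(1) _ that(2)] by blast
    qed
    show ?thesis
    proof (cases "height w = 0")
      case True
      then have "w0 @ [0] \<in> motzkin k n" using wk nn w0 c0 by (auto simp: motzkin_iff)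
      then obtain a b where ab: "w0 @ [0] = a @ b" "a \<in> motzkin k (length a)"
        "b \<in> elevated_motzkin k (length b)" by (rule last_elevated_factor)
      have w1: "w = a @ b" and lab: "n = length a + length b" using ab w0 c0 lw by auto
      have le: "length a \<le> n div 2"
      proof (rule ccontr)
        assume "\<not> ?thesis"
        then have "2 * length b < n" "a \<noteq> []" using lab by auto
        then show False using short[OF w1] ab(3) by blast
      qed
      \<comment> \<open>An elevated first half would be a long elevated factor on the axis with a
        non-empty remainder, which \<open>axis\<close> excludes.\<close>
      have "a \<notin> elevated_motzkin k (length a)" if "even n" "length a = n div 2"
      proof
        assume "a \<in> elevated_motzkin k (length a)"
        moreover have "b \<noteq> []" using elevated_length[OF ab(3)] by auto
        ultimately show False using axis[of "[]" a b] w1 that by auto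
      qed
      moreover have "b \<in> elevated_motzkin k (n - length a)" using ab(3) lab by simp
      ultimately show ?thesis unfolding w1 using A_I[OF ab(2) _ le] by blast
    next
      case False
      then have "0 < height w" using nn[of w "[]"] by simp
      then obtain x a where xa: "w = x @ [1] @ a" "a \<in> motzkin k (length a)"
        using last_ascent[OF wk] by blast
      have "x = []"
      proof (rule ccontr)
        assume x: "x \<noteq> []"
        let ?r = "replicate (n - 2 - length a) 2"
        have lt: "length a \<le> n - 2" using x lw xa by (cases x) auto
        have "length a + (n - 2 - length a) + 2 = n" using lt n by simp
        then have "1 # (a @ ?r) @ [0] \<in> elevated_motzkin k n"
          using elevatedI[OF motzkin_append[OF xa(2) motzkin_replicate[OF k(1)]], of "n - 2 - length a"]
          by metis
        from E[OF this] show False using S[of x "1 # a" "?r @ [0]"] xa x by simp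
      qed
      then have w1: "w = 1 # a" using xa by simp
      with w0 c0 obtain a0 where "a = a0 @ [0]" by (cases w0) auto
      with xa(2) obtain d b where ab: "a = d @ b" "d \<in> motzkin k (length d)"
        "b \<in> elevated_motzkin k (length b)" using last_elevated_factor[of a0 k] by metis
      have l: "n = Suc (length d + length b)" using lw w1 ab(1) by simp
      \<comment> \<open>The part \<open>1 # d\<close> before \<open>b\<close> is never empty, so
        \<open>short\<close> applies; that \<open>b\<close> has at least half the length is exactly
        the bound on \<open>i\<close> in \<open>set_B\<close>.\<close>
      have "\<not> 2 * length b < n" using short[of "1 # d" b] w1 ab by auto
      then have "length d \<le> n div 2 - 1" "length b = n - length d - 1" using l by auto
      then show ?thesis using w1 ab unfolding CBFS_def set_B_def k_def by fastforce
    qed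
  qed
qed

section \<open>From overlaps to cross-bifix-free sets\<close>

theorem proposition3p2:
  fixes q n :: nat
  assumes "3 \<le> q" and "3 \<le> n"
  shows "cross_bifix_free_set q n (CBFS q n) \<and> non_expandable q n (CBFS q n)"
proof
  have len: "length w = n" if "w \<in> CBFS q n" for w
    using CBFS_words[OF assms that] by (simp add: words_def)
  have no: False if "w \<in> CBFS q n" "w' \<in> CBFS q n" "u \<noteq> []" "strict_prefix u w" "suffix u w'" for u w w'
  proof -
    from that(4) obtain v where v: "w = u @ v" "v \<noteq> []" by (auto simp: strict_prefix_def prefix_def)
    moreover from that(5) obtain u' where u': "w' = u' @ u" by (auto simp: suffix_def)
    \<comment> \<open>Both words have length \<open>n\<close>, so a proper prefix of one can only be
      a proper suffix of the other.\<close>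
    moreover have "u' \<noteq> []" using v u' len[OF that(1)] len[OF that(2)] by auto
    ultimately show False using CBFS_no_overlap[of n w q u v w' u'] that assms by auto
  qed
  then show "cross_bifix_free_set q n (CBFS q n)"
    unfolding cross_bifix_free_set_def cross_bifix_free_def BF_def bifix_free_def
    using CBFS_words[OF assms] by blast
  show "non_expandable q n (CBFS q n)"
    unfolding non_expandable_def
  proof (intro ballI notI)
    fix w assume w: "w \<in> BF q n - CBFS q n" and c: "cross_bifix_free_set q n (insert w (CBFS q n))"
    have cr: "cross_bifix_free w w'" if "w' \<in> CBFS q n" for w'
    proof -
      have "w \<noteq> w'" using w that by auto
      then show ?thesis using c that by (simp add: cross_bifix_free_set_def)
    qed
    have "w \<in> CBFS q n"
    proof (rule maximality[OF assms])
      show "w \<in> words q n" using w by (simp add: BF_def)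
      show "s @ u \<notin> CBFS q n" if "w = u @ v" "u \<noteq> []" "v \<noteq> []" for u v s
      proof -
        have "strict_prefix u w" "suffix u (s @ u)" using that by (auto simp: strict_prefix_def suffixI)
        then show ?thesis using cr[of "s @ u"] that(2) unfolding cross_bifix_free_def by blast
      qed
      show "u @ s \<notin> CBFS q n" if "w = v @ u" "u \<noteq> []" "v \<noteq> []" for u v s
      proof
        assume us: "u @ s \<in> CBFS q n"
        have "length w = n" using w by (simp add: BF_def words_def)
        then have "s \<noteq> []" using len[OF us] that by auto
        then have "strict_prefix u (u @ s)" "suffix u w" using that by (auto simp: strict_prefix_def suffix_def)
        then show False using cr[OF us] that(2) unfolding cross_bifix_free_def by blast
      qed
    qed
    then show False using w by simp
  qed
qed

end
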